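(* The semiring $\operatorname{Trop}[x_{1,1},x_{1,2},x_{2,1},x_{2,2}]^{S_2}$ of 2-symmetric tropical polynomials is not finitely generated; that is, there is no finite subset $G$ of it such that every element of it is a finite tropical sum of terms $a\odot g_1\odot\cdots\odot g_l$ with $a\in\mathbb{R}$, $l\ge0$ and $g_1,\ldots,g_l\in G$ (repetitions allowed), with equality as functions.
   Context: Tropical arithmetic: $a\oplus b=\min(a,b)$, $a\odot b=a+b$; $x^i$ is the tropical power (ordinary $i\cdot x$). A tropical polynomial expression in given variables is a finite (nonempty) tropical sum of terms $a\odot(\text{monomial})$ with $a\in\mathbb{R}$, where a monomial is a tropical product of integer (possibly negative) powers of the variables; it defines a function (a minimum of finitely many affine functions with integer slopes) on the real vector space with those coordinates. $\operatorname{Trop}[\ldots]$ is the semiring of such expressions modulo defining the same function; its elements are called tropical polynomials. $S_2$ acts by exchanging the pairs $(x_{1,1},x_{1,2})$ and $(x_{2,1},x_{2,2})$; a tropical polynomial $p$ is 2-symmetric if $p(x_{1,1},x_{1,2},x_{2,1},x_{2,2})=p(x_{2,1},x_{2,2},x_{1,1},x_{1,2})$, and $\operatorname{Trop}[x_{1,1},x_{1,2},x_{2,1},x_{2,2}]^{S_2}$ is the semiring of all 2-symmetric tropical polynomials. *)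

theory Defs
  imports "HOL-Analysis.Analysis"
begin

text \<open>
  Tropical arithmetic on the reals is written in ordinary notation: tropical sum is \<open>min\<close>,
  tropical product is \<open>+\<close>, and the tropical power \<open>x\<^sup>k\<close> is \<open>k * x\<close>.  There is no neutral element
  for the tropical sum, so every tropical sum below is nonempty.
\<close>

definition trop_term :: "real \<times> (int ^ 'v) \<Rightarrow> real ^ 'v \<Rightarrow> real" where
  "trop_term t x = fst t + (\<Sum>v\<in>UNIV. of_int (snd t $ v) * x $ v)"

text \<open>
  An expression is given by its finite nonempty set of terms (coefficient, exponent vector);
  repeated terms do not matter since \<open>min\<close> is idempotent.
\<close>

definition trop_eval :: "(real \<times> (int ^ 'v)) set \<Rightarrow> real ^ 'v \<Rightarrow> real" where
  "trop_eval T x = Min ((\<lambda>t. trop_term t x) ` T)"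

text \<open>
  An expression modulo defining the same function is identified with that function.
\<close>

definition Trop :: "(real ^ 'v \<Rightarrow> real) set" where
  "Trop = {trop_eval T | T. finite T \<and> T \<noteq> {}}"

text \<open>
  The functions \<open>\<Oplus> a \<odot> g\<^sub>1 \<odot> \<dots> \<odot> g\<^sub>l\<close>, the sum running over a finite nonempty set of
  pairs \<open>(a, [g\<^sub>1, \<dots>, g\<^sub>l])\<close> with all \<open>g\<^sub>i\<close> in \<open>G\<close>.
\<close>

definition trop_generated :: "('x \<Rightarrow> real) set \<Rightarrow> ('x \<Rightarrow> real) set" where
  "trop_generated G =
     {(\<lambda>x. Min ((\<lambda>(a, gs). a + (\<Sum>g\<leftarrow>gs. g x)) ` T)) | T.
        finite T \<and> T \<noteq> {} \<and> (\<forall>(a, gs)\<in>T. set gs \<subseteq> G)}"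

definition trop_finitely_generated :: "('x \<Rightarrow> real) set \<Rightarrow> bool" where
  "trop_finitely_generated S \<longleftrightarrow> (\<exists>G. finite G \<and> G \<subseteq> S \<and> S \<subseteq> trop_generated G)"

text \<open>
  The variable \<open>x\<^sub>i\<^sub>,\<^sub>j\<close> is the coordinate \<open>x $ (i, j)\<close>, where \<open>i, j\<close> range over the two elements
  \<open>1, 2\<close> of the type \<open>2\<close>.
\<close>

definition point :: "real \<Rightarrow> real \<Rightarrow> real \<Rightarrow> real \<Rightarrow> real ^ (2 \<times> 2)" where
  "point x11 x12 x21 x22 =
     (\<chi> v. if v = (1, 1) then x11 else if v = (1, 2) then x12
           else if v = (2, 1) then x21 else x22)"

definition two_symmetric :: "(real ^ (2 \<times> 2) \<Rightarrow> real) \<Rightarrow> bool" where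
  "two_symmetric p \<longleftrightarrow>
     (\<forall>x11 x12 x21 x22. p (point x11 x12 x21 x22) = p (point x21 x22 x11 x12))"

definition Trop_S2 :: "(real ^ (2 \<times> 2) \<Rightarrow> real) set" where
  "Trop_S2 = {p \<in> Trop. two_symmetric p}"

lemma point_nth [simp]:
  "point a b c d $ (1, 1) = a" "point a b c d $ (1, 2) = b"
  "point a b c d $ (2, 1) = c" "point a b c d $ (2, 2) = d"
  by (simp_all add: point_def)

lemma point_surj: "x = point (x $ (1, 1)) (x $ (1, 2)) (x $ (2, 1)) (x $ (2, 2))"
proof -
  have "x $ (i, j) = point (x $ (1, 1)) (x $ (1, 2)) (x $ (2, 1)) (x $ (2, 2)) $ (i, j)"
    for i j :: 2
    using exhaust_2[of i] exhaust_2[of j] by auto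
  then show ?thesis unfolding vec_eq_iff split_paired_All by blast
qed

lemma Trop_min:
  assumes "p \<in> Trop" "q \<in> Trop" shows "(\<lambda>x. min (p x) (q x)) \<in> Trop"
proof -
  obtain S T where S: "finite S" "S \<noteq> {}" "p = trop_eval S"
    and T: "finite T" "T \<noteq> {}" "q = trop_eval T"
    using assms by (auto simp: Trop_def)
  then have "(\<lambda>x. min (p x) (q x)) = trop_eval (S \<union> T)"
    by (simp add: fun_eq_iff trop_eval_def image_Un Min_Un)
  with S T show ?thesis by (auto simp: Trop_def)
qed

lemma Trop_add:
  fixes p q :: "real ^ 'v \<Rightarrow> real"
  assumes "p \<in> Trop" "q \<in> Trop" shows "(\<lambda>x. p x + q x) \<in> Trop"
proof -
  obtain S T where S: "finite S" "S \<noteq> {}" "p = trop_eval S"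
    and T: "finite T" "T \<noteq> {}" "q = trop_eval T"
    using assms by (auto simp: Trop_def)
  define U where "U = (\<lambda>(s, t). (fst s + fst t, snd s + snd t)) ` (S \<times> T)"
  have term_add: "trop_term (a + b, m + n) x = trop_term (a, m) x + trop_term (b, n) x"
    for a b and m n :: "int ^ 'v" and x
    by (simp add: trop_term_def sum.distrib distrib_right)
  have U: "(\<lambda>u. trop_term u x) ` U = (\<lambda>(s, t). trop_term s x + trop_term t x) ` (S \<times> T)" for x
    unfolding U_def image_image by (intro image_cong) (auto simp: term_add)
  have "p x + q x = trop_eval U x" for x
  proof -
    have fin: "finite ((\<lambda>(s, t). trop_term s x + trop_term t x) ` (S \<times> T))"
      using S T by simp
    have "Min ((\<lambda>t. trop_term t x) ` S) \<in> (\<lambda>t. trop_term t x) ` S"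
      "Min ((\<lambda>t. trop_term t x) ` T) \<in> (\<lambda>t. trop_term t x) ` T"
      using S T by (auto intro!: Min_in simp del: Min_in)
    then have "p x + q x \<in> (\<lambda>(s, t). trop_term s x + trop_term t x) ` (S \<times> T)"
      by (force simp: S(3) T(3) trop_eval_def)
    moreover have "p x + q x \<le> y" if "y \<in> (\<lambda>(s, t). trop_term s x + trop_term t x) ` (S \<times> T)" for y
      using that S T by (auto simp: trop_eval_def intro!: add_mono)
    ultimately show ?thesis
      unfolding trop_eval_def U using fin by (intro Min_eqI[symmetric]) auto
  qed
  moreover have "finite U" "U \<noteq> {}" using S T by (auto simp: U_def)
  ultimately show ?thesis by (auto simp: Trop_def intro!: exI[of _ U])
qed

end

theory Submission
  imports Defs
begin

text \<open>
  For \<open>n > 0\<close> consider the 2-symmetric polynomial \<open>f = x\<^sub>1\<^sub>1\<^sup>n x\<^sub>1\<^sub>2 \<oplus> x\<^sub>2\<^sub>1\<^sup>n x\<^sub>2\<^sub>2\<close>.  Its Newton polytope is a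
  segment whose only lattice points are its two ends \<open>(n, 1, 0, 0)\<close> and \<open>(0, 0, n, 1)\<close>.  If \<open>f\<close> is
  a tropical sum of terms \<open>a \<odot> g\<^sub>1 \<odot> \<dots> \<odot> g\<^sub>l\<close>, then each such term dominates \<open>f\<close>, so
  however one picks a monomial from every \<open>g\<^sub>i\<close>, the product of these monomials is one of the two
  ends.  Two monomials of the same \<open>g\<^sub>i\<close> hence have \<open>x\<^sub>1\<^sub>1\<close>-exponents differing by \<open>0\<close> or \<open>\<plusminus>n\<close>.
  When \<open>n\<close> exceeds all such differences occurring in the finitely many generators, all monomials of
  \<open>g\<^sub>i\<close> have the same \<open>x\<^sub>1\<^sub>2\<close>- and \<open>x\<^sub>2\<^sub>2\<close>-exponents, and these two agree since \<open>g\<^sub>i\<close> is 2-symmetric.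
  So they also agree in the product, but not in either end.
\<close>

lemma trop_term_point:
  "trop_term t (point a b c d) =
     fst t + of_int (snd t $ (1, 1)) * a + of_int (snd t $ (1, 2)) * b
       + of_int (snd t $ (2, 1)) * c + of_int (snd t $ (2, 2)) * d"
proof -
  have *: "(UNIV :: (2 \<times> 2) set) = {(1, 1), (1, 2), (2, 1), (2, 2)}"
    by (auto simp: UNIV_2 simp flip: UNIV_Times_UNIV)
  show ?thesis unfolding trop_term_def * by simp
qed

lemma trop_term_add: "trop_term (s + t) x = trop_term s x + trop_term t x"
  by (simp add: trop_term_def sum.distrib distrib_right)

lemma trop_term_sum_list: "trop_term (\<Sum>h\<leftarrow>hs. \<sigma> h) x = (\<Sum>h\<leftarrow>hs. trop_term (\<sigma> h) x)"
  by (induction hs) (simp add: trop_term_def, simp add: trop_term_add)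

lemma trop_eval_le: "finite T \<Longrightarrow> t \<in> T \<Longrightarrow> trop_eval T x \<le> trop_term t x"
  by (simp add: trop_eval_def)

lemma slope_nonneg:
  fixes c k :: real
  assumes "\<And>t. t \<ge> 0 \<Longrightarrow> 0 \<le> c + t * k"
  shows "0 \<le> k"
proof (rule ccontr)
  assume "\<not> 0 \<le> k"
  then have "k < 0" by simp
  \<comment> \<open>At this parameter \<open>c + t * k\<close> equals
    \<open>c - \<bar>c\<bar> - 1\<close>, which is negative.\<close>
  then have "0 \<le> (\<bar>c\<bar> + 1) / (- k)" "(\<bar>c\<bar> + 1) / (- k) * k = - \<bar>c\<bar> - 1"
    by (simp_all add: divide_nonneg_neg)
  then show False
    using assms[of "(\<bar>c\<bar> + 1) / (- k)"] by linarith
qed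

lemma slope_zero:
  fixes c k :: real
  assumes "\<And>t. 0 \<le> c + t * k"
  shows "k = 0"
  using slope_nonneg[of c k] slope_nonneg[of c "- k"] assms
  by (metis antisym minus_mult_commute neg_0_le_iff_le)

text \<open>Along a line or ray where the minimum is linear, domination constrains the slope of
  \<open>t\<close>: direction \<open>(1, -n, 0, 0)\<close> gives \<open>p = n * q\<close>, direction
  \<open>(0, 1, 0, 1)\<close> gives \<open>q + s = 1\<close>, and the rays along \<open>x12\<close>
  and \<open>x22\<close> give \<open>0 \<le> q\<close> and \<open>0 \<le> s\<close>. Integrality
  leaves two cases.\<close>

lemma exponent_of_dominating_term:
  fixes n :: int
  assumes "\<And>a b c d. min (of_int n * a + b) (of_int n * c + d) \<le> trop_term t (point a b c d)"
  shows "snd t $ (1, 1) = n \<and> snd t $ (1, 2) = 1 \<and> snd t $ (2, 2) = 0 \<or>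
         snd t $ (1, 1) = 0 \<and> snd t $ (1, 2) = 0 \<and> snd t $ (2, 2) = 1"
proof -
  define p q r s where "p = snd t $ (1, 1)" and "q = snd t $ (1, 2)"
    and "r = snd t $ (2, 1)" and "s = snd t $ (2, 2)"
  have ineq: "min (of_int n * a + b) (of_int n * c + d)
      \<le> fst t + of_int p * a + of_int q * b + of_int r * c + of_int s * d" for a b c d :: real
    using assms[of a b c d] by (simp add: trop_term_point p_def q_def r_def s_def)
  have "real_of_int p - of_int n * of_int q = 0"
  proof (rule slope_zero[of "fst t"])
    show "0 \<le> fst t + u * (real_of_int p - of_int n * of_int q)" for u
      using ineq[of u "- of_int n * u" 0 0] by (simp add: algebra_simps)
  qed
  then have p: "p = n * q" by (simp flip: of_int_mult of_int_diff)
  have "real_of_int q + of_int s - 1 = 0"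
  proof (rule slope_zero[of "fst t"])
    show "0 \<le> fst t + u * (real_of_int q + of_int s - 1)" for u
      using ineq[of 0 u 0 u] by (simp add: algebra_simps)
  qed
  then have qs: "q + s = 1" by linarith
  have "0 \<le> real_of_int q"
  proof (rule slope_nonneg[of "fst t"])
    show "0 \<le> fst t + u * real_of_int q" if "u \<ge> 0" for u
      using ineq[of 0 u 0 0] that by (simp add: mult.commute)
  qed
  moreover have "0 \<le> real_of_int s"
  proof (rule slope_nonneg[of "fst t"])
    show "0 \<le> fst t + u * real_of_int s" if "u \<ge> 0" for u
      using ineq[of 0 0 0 u] that by (simp add: mult.commute)
  qed
  ultimately have "q = 1 \<and> s = 0 \<or> q = 0 \<and> s = 1" using qs by simp linarith
  with p show ?thesis unfolding p_def q_def s_def by auto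
qed

definition power_sum :: "int \<Rightarrow> real ^ (2 \<times> 2) \<Rightarrow> real" where
  "power_sum n x = min (of_int n * x $ (1, 1) + x $ (1, 2)) (of_int n * x $ (2, 1) + x $ (2, 2))"

lemma power_sum_in_Trop_S2: "power_sum n \<in> Trop_S2"
proof -
  define m :: "2 \<Rightarrow> int ^ (2 \<times> 2)"
    where "m i = (\<chi> v. if fst v = i then if snd v = 1 then n else 1 else 0)" for i
  have "power_sum n x = trop_eval {(0, m 1), (0, m 2)} x" for x
    by (subst (1 2) point_surj) (simp add: trop_eval_def trop_term_point m_def power_sum_def)
  then have "power_sum n = trop_eval {(0, m 1), (0, m 2)}" by blast
  then have "power_sum n \<in> Trop"
    unfolding Trop_def by blast
  moreover have "two_symmetric (power_sum n)"
    by (simp add: two_symmetric_def power_sum_def min.commute)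
  ultimately show ?thesis by (simp add: Trop_S2_def)
qed

theorem proposition5p9: "\<not> trop_finitely_generated Trop_S2"
proof
  assume "trop_finitely_generated Trop_S2"
  then obtain G where G: "finite G" "G \<subseteq> Trop_S2" "Trop_S2 \<subseteq> trop_generated G"
    by (auto simp: trop_finitely_generated_def)
  then have "\<forall>g\<in>G. \<exists>T. finite T \<and> T \<noteq> {} \<and> g = trop_eval T"
    unfolding Trop_S2_def Trop_def by blast
  then obtain R where R: "\<And>g. g \<in> G \<Longrightarrow> finite (R g) \<and> R g \<noteq> {} \<and> g = trop_eval (R g)"
    by metis
  define D where "D = (\<Union>g\<in>G. (\<lambda>(s, t). \<bar>snd s $ (1, 1) - snd t $ (1, 1)\<bar>) ` (R g \<times> R g))"
  \<comment> \<open>Inserting \<open>0\<close> covers an empty \<open>D\<close> and, with the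
    \<open>+ 1\<close>, makes \<open>n\<close> positive.\<close>
  define n where "n = Max (insert 0 D) + 1"
  have "finite D" using G(1) R by (auto simp: D_def)
  then have D: "d < n" if "d \<in> D" for d
    using that by (simp add: n_def less_le_trans zle_add1_eq_le)
  have n: "n > 0" using \<open>finite D\<close> by (auto simp: n_def intro: zle_add1_eq_le[THEN iffD2])
  obtain T where T: "finite T" "T \<noteq> {}" "\<forall>(a, gs)\<in>T. set gs \<subseteq> G"
    and f: "power_sum n = (\<lambda>x. Min ((\<lambda>(a, gs). a + (\<Sum>g\<leftarrow>gs. g x)) ` T))"
    using subsetD[OF G(3) power_sum_in_Trop_S2[of n]] unfolding trop_generated_def by blast
  \<comment> \<open>A single term of the tropical sum already leads to a contradiction.\<close>
  from T(2) obtain c gs where cgs: "(c, gs) \<in> T" by auto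
  with T(3) have gs: "set gs \<subseteq> G" by auto
  have le: "power_sum n x \<le> c + (\<Sum>g\<leftarrow>gs. g x)" for x
    unfolding f using T(1) cgs by (force intro!: Min_le)
  define \<sigma> where "\<sigma> g = (SOME t. t \<in> R g)" for g
  have \<sigma>: "\<sigma> g \<in> R g" if "g \<in> G" for g
    using R[OF that] by (simp add: \<sigma>_def some_in_eq)
  have le_term: "g x \<le> trop_term t x" if "g \<in> G" "t \<in> R g" for g t x
    using R[OF that(1)] trop_eval_le that(2) by metis
  have le_sigma: "g x \<le> trop_term (\<sigma> g) x" if "g \<in> set gs" for g x
    using that gs by (blast intro: le_term \<sigma>)
  have ends: "snd u $ (1, 1) = n \<and> snd u $ (1, 2) = 1 \<and> snd u $ (2, 2) = 0 \<or>
       snd u $ (1, 1) = 0 \<and> snd u $ (1, 2) = 0 \<and> snd u $ (2, 2) = 1"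
    if "\<And>x. c + (\<Sum>g\<leftarrow>gs. g x) \<le> trop_term u x" for u
  proof (rule exponent_of_dominating_term)
    fix x11 x12 x21 x22
    show "min (real_of_int n * x11 + x12) (real_of_int n * x21 + x22)
        \<le> trop_term u (point x11 x12 x21 x22)"
      using order_trans[OF le that, of "point x11 x12 x21 x22"] by (simp add: power_sum_def)
  qed
  have const_term: "trop_term (c, 0) x = c" for x :: "real ^ (2 \<times> 2)"
    by (simp add: trop_term_def)
  have same_exponent: "snd s $ (1, 2) = snd (\<sigma> g) $ (1, 2) \<and> snd s $ (2, 2) = snd (\<sigma> g) $ (2, 2)"
    if g: "g \<in> set gs" and s: "s \<in> R g" for g s
  proof -
    obtain ys zs where split: "gs = ys @ g # zs"
      using g by (meson split_list)
    \<comment> \<open>Only one occurrence of \<open>g\<close> contributes \<open>t\<close>; all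
      other factors keep their chosen term, so \<open>u s\<close> and \<open>u (\<sigma> g)\<close>
      differ exactly as \<open>s\<close> and \<open>\<sigma> g\<close> do.\<close>
    define u where "u t = (c, 0) + t + (\<Sum>h\<leftarrow>ys @ zs. \<sigma> h)" for t
    have "c + (\<Sum>g\<leftarrow>gs. g x) \<le> trop_term (u t) x" if "t \<in> R g" for t x
    proof -
      have "(\<Sum>h\<leftarrow>ys @ zs. h x) \<le> (\<Sum>h\<leftarrow>ys @ zs. trop_term (\<sigma> h) x)"
        by (rule sum_list_mono) (use split le_sigma in auto)
      moreover have "g x \<le> trop_term t x"
        using g gs le_term that by blast
      ultimately show ?thesis
        unfolding u_def trop_term_add trop_term_sum_list const_term by (simp add: split)
    qed
    note this[THEN ends]
    \<comment> \<open>Both products are ends: either the same one, or opposite ones, whose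
      \<open>x11\<close>-exponents differ by \<open>n\<close>.\<close>
    from this[OF s] this[OF \<sigma>[of g]] g gs
    consider "snd (u s) $ (1, 2) = snd (u (\<sigma> g)) $ (1, 2)" "snd (u s) $ (2, 2) = snd (u (\<sigma> g)) $ (2, 2)"
      | "\<bar>snd (u s) $ (1, 1) - snd (u (\<sigma> g)) $ (1, 1)\<bar> = n"
      using n by fastforce
    then show ?thesis
    proof cases
      case 1
      then show ?thesis by (simp add: u_def)
    next
      case 2
      then have "n \<in> D"
        using g gs s \<sigma>[of g] by (force simp: u_def D_def)
      then show ?thesis using D by blast
    qed
  qed
  have symmetric_exponent: "snd (\<sigma> g) $ (1, 2) = snd (\<sigma> g) $ (2, 2)" if g: "g \<in> set gs" for g
  proof -
    have gG: "g \<in> G" using g gs by blast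
    define \<mu> where "\<mu> = Min (fst ` R g)"
    \<comment> \<open>By \<open>same_exponent\<close>, a unit step from the origin along
      \<open>x12\<close> or \<open>x22\<close> shifts all terms of \<open>g\<close> equally, hence
      also their minimum \<open>\<mu>\<close>. Symmetry of \<open>g\<close> then equates the two
      shifts.\<close>
    have shift: "Min ((\<lambda>t. fst t + k) ` R g) = \<mu> + k" for k
      unfolding \<mu>_def using R[OF gG] by (subst Min_add_commute) auto
    have "g (point 0 1 0 0) = Min ((\<lambda>t. fst t + of_int (snd (\<sigma> g) $ (1, 2))) ` R g)"
      using same_exponent[OF g]
      by (subst conjunct2[OF conjunct2[OF R[OF gG]]])
         (auto simp: trop_eval_def trop_term_point intro!: arg_cong[of _ _ Min] image_cong)
    moreover have "g (point 0 0 0 1) = Min ((\<lambda>t. fst t + of_int (snd (\<sigma> g) $ (2, 2))) ` R g)"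
      using same_exponent[OF g]
      by (subst conjunct2[OF conjunct2[OF R[OF gG]]])
         (auto simp: trop_eval_def trop_term_point intro!: arg_cong[of _ _ Min] image_cong)
    moreover have "g (point 0 1 0 0) = g (point 0 0 0 1)"
      using G(2) gG by (auto simp: Trop_S2_def two_symmetric_def)
    ultimately show ?thesis by (simp add: shift)
  qed
  \<comment> \<open>This product must be an end, where the \<open>x12\<close>- and
    \<open>x22\<close>-exponents are \<open>0\<close> and \<open>1\<close> in some order, yet every
    factor has them equal.\<close>
  define u where "u = (c, 0) + (\<Sum>h\<leftarrow>gs. \<sigma> h)"
  have "c + (\<Sum>g\<leftarrow>gs. g x) \<le> trop_term u x" for x
    unfolding u_def trop_term_add trop_term_sum_list const_term
    using le_sigma by (auto intro!: sum_list_mono)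
  note ends[OF this]
  moreover have "snd (\<Sum>h\<leftarrow>hs. \<sigma> h) $ (1, 2) = snd (\<Sum>h\<leftarrow>hs. \<sigma> h) $ (2, 2)" if "set hs \<subseteq> set gs" for hs
    using that by (induction hs) (auto simp: symmetric_exponent)
  then have "snd u $ (1, 2) = snd u $ (2, 2)" by (simp add: u_def)
  ultimately show False by auto
qed

end
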